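(* Let $a,b,c,d,z\in\mathbb{C}$ be fixed. (1) Assume that $c,d\notin\mathbb{Z}$. Then for any positive integer $N$, $${}_2F_2\biggl[\begin{matrix}a-n,b\\ c-n,d-n\end{matrix};z\biggr]=\sum_{k=0}^{N-1}\frac{(a-n)_k(b)_k}{(c-n)_k(d-n)_k}\frac{z^k}{k!}+\mathcal{O}\bigl(n^{-N}\bigr)$$ as $n\to+\infty$ through integer values. (2) Assume that $a,b,c,d\notin\mathbb{Z}$. Then for any positive integer $N$, $${}_2F_2\biggl[\begin{matrix}a-n,b-n\\ c-n,d-n\end{matrix};z\biggr]=\mathrm{e}^z\sum_{k=0}^{N-1}\frac{(a-n)_k(d-b)_k}{(c-n)_k(d-n)_k}\frac{(-z)^k}{k!}\,{}_1F_1\biggl[\begin{matrix}c-a\\ c-n+k\end{matrix};z\biggr]+\mathcal{O}\bigl(n^{-N}\bigr)$$ as $n\to+\infty$ through integer values.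
   Context: $(\cdot)_k$ is the Pochhammer symbol and ${}_pF_q\bigl[\begin{smallmatrix}a_1,\dots,a_p\\ b_1,\dots,b_q\end{smallmatrix};z\bigr]=\sum_{n=0}^{\infty}\frac{(a_1)_n\cdots(a_p)_n}{(b_1)_n\cdots(b_q)_n}\frac{z^n}{n!}$ is the generalized hypergeometric function, with $a_j\in\mathbb{C}$ and $b_j\in\mathbb{C}\setminus\mathbb{Z}_{\leqslant0}$.
   Formalization: In part (2) the argument of the 1F1 factor is −z instead of the printed z; with z the claim fails for N=2, e.g. a=3/2, b=c=d=1/2, z=1, where the error is 2e/(1/2−n), which is not O(n^{-2}). *)

theory Defs
  imports "HOL-Analysis.Analysis" "HOL-Library.Landau_Symbols"
begin

text \<open>
  The generalized hypergeometric function with upper parameters \<open>as\<close> and lower parameters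
  \<open>bs\<close>, as the sum of the library's formal hypergeometric series with scaling constant 1.
  It is meaningful only if no lower parameter is a non-positive integer (for other \<open>bs\<close>,
  division by zero yields junk coefficients) and the series converges at \<open>z\<close>, which is automatic
  when \<open>length as \<le> length bs\<close>.
\<close>
definition hypergeometric :: "complex list \<Rightarrow> complex list \<Rightarrow> complex \<Rightarrow> complex" where
  "hypergeometric as bs z = eval_fps (fps_hypergeo as bs 1) z"

lemma hypergeometric_series:
  "hypergeometric as bs z =
     (\<Sum>n. (\<Prod>a\<leftarrow>as. pochhammer a n) / (\<Prod>b\<leftarrow>bs. pochhammer b n) * (z ^ n / fact n))"
proof -
  have foldl_eq: "foldl (\<lambda>r a. r * pochhammer a n) x xs = x * (\<Prod>a\<leftarrow>xs. pochhammer a n)"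
    for x :: complex and xs n
    by (induction xs arbitrary: x) (simp_all add: mult.assoc)
  show ?thesis
    by (simp add: hypergeometric_def eval_fps_def foldl_eq)
qed

end

theory Submission
  imports Defs
begin

text \<open>
  Both expansions are convergent series in \<open>k\<close> whose terms depend on \<open>n\<close>, and each says that cutting
  the series off at \<open>k = N\<close> costs only \<open>O(n\<^sup>-\<^sup>N)\<close>. A fixed term has this size because
  \<open>(d - n)\<^sub>k\<close> grows like \<open>n\<^sup>k\<close> while the other factors stay bounded. The danger lies in the terms with
  \<open>k\<close> near or beyond \<open>n\<close>, where the factors \<open>d - n + j\<close> come close to \<open>0\<close>.

  The comparison product \<open>shifted_fact i k = (\<Prod>j<k. 1 + \<bar>i + j\<bar>)\<close> deals with all \<open>k\<close> at once. If
  \<open>d\<close> is not an integer, then \<open>\<bar>d + j\<bar>\<close> is comparable to \<open>1 + \<bar>j\<bar>\<close> for all integers \<open>j\<close>, so that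
  \<open>\<bar>(d + i)\<^sub>k\<bar>\<close> agrees with \<open>shifted_fact i k\<close> up to a factor \<open>K\<^sup>k\<close> that is uniform in \<open>i\<close>. A loss of
  \<open>K\<^sup>k\<close> is harmless: at least \<open>m!/2\<^sup>m\<close> of the product remains after its first \<open>N\<close> factors have
  supplied \<open>(n + 1)\<^sup>N/N!\<close> (\<open>power_fact_le_shifted_fact\<close>), and \<open>B\<^sup>m/m!\<close> is summable. This is
  \<open>series_tail_bigo\<close>, and the first expansion is an instance of it.

  The second hypergeometric function has \<open>n\<close> in all four parameters, so its own terms do not decay in
  \<open>n\<close>. Expanding the quotient \<open>(b - n)\<^sub>m/(d - n)\<^sub>m\<close> by the Chu--Vandermonde identity and interchanging
  the two sums turns it into a series whose terms carry the decaying factor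
  \<open>(d - b)\<^sub>k/(d - n)\<^sub>k\<close> times a confluent function \<open>\<^sub>1F\<^sub>1\<close> with parameters \<open>a - n + k\<close>, \<open>c - n + k\<close>
  (\<open>hypergeometric_2F2_as_1F1_series\<close>). These confluent functions are bounded uniformly in \<open>n\<close> and
  \<open>k\<close>, and Kummer's transformation, itself a case of the same interchange, gives them the form in
  which they appear in the expansion.
\<close>

section \<open>Pochhammer symbols with shifted parameters\<close>

definition shifted_fact :: "int \<Rightarrow> nat \<Rightarrow> real" where
  "shifted_fact i k = (\<Prod>j<k. 1 + \<bar>real_of_int i + real j\<bar>)"

lemma shifted_fact_pos: "shifted_fact i k > 0"
  unfolding shifted_fact_def by (intro prod_pos) auto

lemma shifted_fact_0_left: "shifted_fact 0 k = fact k"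
  by (induction k) (simp_all add: shifted_fact_def mult.commute)

lemma shifted_fact_add:
  "shifted_fact i (k + m) = shifted_fact i k * shifted_fact (i + int k) m"
  by (induction m) (simp_all add: shifted_fact_def algebra_simps)

text \<open>
  Among \<open>m + 1\<close> consecutive integers one of the two extreme ones has absolute value at least \<open>m/2\<close>.
  Removing it leaves \<open>m\<close> consecutive integers, whence the induction over all starting points.
\<close>
lemma fact_le_shifted_fact: "fact m \<le> 2 ^ m * shifted_fact i m"
proof (induction m arbitrary: i)
  case 0
  show ?case by (simp add: shifted_fact_def)
next
  case (Suc m)
  have "\<exists>i' x. shifted_fact i (Suc m) = x * shifted_fact i' m \<and> real (Suc m) \<le> 2 * x"
  proof (cases "2 * i \<ge> - int m")
    case True
    have "shifted_fact i (Suc m) = (1 + \<bar>real_of_int i + real m\<bar>) * shifted_fact i m"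
      by (simp add: shifted_fact_def)
    moreover have "real (Suc m) \<le> 2 * (1 + \<bar>real_of_int i + real m\<bar>)"
    proof -
      have "real_of_int (- int m) \<le> real_of_int (2 * i)"
        using True by (simp only: of_int_le_iff)
      then show ?thesis by (simp add: abs_if)
    qed
    ultimately show ?thesis by blast
  next
    case False
    have "shifted_fact i (Suc m) = (1 + \<bar>real_of_int i\<bar>) * shifted_fact (i + 1) m"
      using shifted_fact_add[of i 1 m] by (simp add: shifted_fact_def)
    moreover have "real (Suc m) \<le> 2 * (1 + \<bar>real_of_int i\<bar>)"
    proof -
      have "real_of_int (2 * i) < real_of_int (- int m)"
        using False by (simp only: of_int_less_iff)
      then show ?thesis by (simp add: abs_if)
    qed
    ultimately show ?thesis by blast
  qed
  then obtain i' x where x: "shifted_fact i (Suc m) = x * shifted_fact i' m"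
      "real (Suc m) \<le> 2 * x" by blast
  have "fact (Suc m) = real (Suc m) * fact m" by simp
  also have "\<dots> \<le> (2 * x) * (2 ^ m * shifted_fact i' m)"
    using Suc.IH[of i'] x(2) by (intro mult_mono) auto
  also have "\<dots> = 2 ^ Suc m * shifted_fact i (Suc m)" by (simp add: x(1))
  finally show ?case .
qed

text \<open>
  Each factor contributes one power of \<open>n + 1\<close>, since
  \<open>(1 + j) (1 + \<bar>j - n\<bar>) \<ge> 1 + j + \<bar>j - n\<bar> \<ge> n + 1\<close>; the factors \<open>1 + j\<close> multiply up to \<open>N!\<close>.
\<close>
lemma power_le_shifted_fact:
  "(real n + 1) ^ N \<le> fact N * shifted_fact (- int n) N"
proof (induction N)
  case 0
  show ?case by (simp add: shifted_fact_def)
next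
  case (Suc N)
  have "real n + 1 \<le> (1 + real N) + \<bar>real N - real n\<bar>" by linarith
  also have "\<dots> \<le> real (Suc N) * (1 + \<bar>real N - real n\<bar>)"
    by (simp add: algebra_simps)
  finally have "(real n + 1) * (real n + 1) ^ N
      \<le> (real (Suc N) * (1 + \<bar>real N - real n\<bar>)) * (fact N * shifted_fact (- int n) N)"
    using Suc by (intro mult_mono) auto
  also have "\<dots> = fact (Suc N) * shifted_fact (- int n) (Suc N)"
    by (simp add: shifted_fact_def algebra_simps)
  finally show ?case by simp
qed

text \<open>
  The first \<open>N\<close> factors provide the decay in \<open>n\<close>, the remaining \<open>m\<close> factors the summability in \<open>m\<close>,
  uniformly in \<open>n\<close>.
\<close>
lemma power_fact_le_shifted_fact:
  "(real n + 1) ^ N * fact m \<le> fact N * 2 ^ m * shifted_fact (- int n) (N + m)"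
proof -
  have "(real n + 1) ^ N * fact m
      \<le> (fact N * shifted_fact (- int n) N) * (2 ^ m * shifted_fact (- int n + int N) m)"
    using shifted_fact_pos[of "- int n" N]
    by (intro mult_mono power_le_shifted_fact fact_le_shifted_fact) auto
  then show ?thesis by (simp add: shifted_fact_add mult_ac)
qed

lemma norm_pochhammer_le:
  fixes a :: complex
  shows "norm (pochhammer (a + of_int i) k) \<le> (1 + norm a) ^ k * shifted_fact i k"
proof (induction k)
  case 0
  show ?case by (simp add: shifted_fact_def)
next
  case (Suc k)
  have "norm (a + of_int i + of_nat k) \<le> norm a + norm (of_int i + of_nat k :: complex)"
    by (simp add: add.assoc norm_triangle_ineq)
  also have "norm (of_int i + of_nat k :: complex) = \<bar>real_of_int i + real k\<bar>"
    by (metis norm_of_int of_int_add of_int_of_nat_eq)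
  also have "norm a + \<bar>real_of_int i + real k\<bar> \<le> (1 + norm a) * (1 + \<bar>real_of_int i + real k\<bar>)"
    by (simp add: algebra_simps)
  finally have "norm (pochhammer (a + of_int i) k) * norm (a + of_int i + of_nat k)
      \<le> ((1 + norm a) ^ k * shifted_fact i k) * ((1 + norm a) * (1 + \<bar>real_of_int i + real k\<bar>))"
    using Suc shifted_fact_pos[of i k] by (intro mult_mono) auto
  then show ?case
    by (simp add: pochhammer_rec' shifted_fact_def norm_mult mult_ac)
qed

text \<open>
  A non-integer \<open>c\<close> has a positive distance \<open>e\<close> from the closed set of integers, so
  \<open>\<bar>c + j\<bar>\<close> is at least \<open>e\<close> for every integer \<open>j\<close>, and for large \<open>\<bar>j\<bar>\<close> it grows linearly. Together these
  bound \<open>1 + \<bar>j\<bar>\<close> by a multiple of \<open>\<bar>c + j\<bar>\<close>. It matters that the same \<open>K\<close> serves every shift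
  \<open>i\<close>, as the shift is later \<open>- n\<close> or \<open>k - n\<close>.
\<close>
lemma shifted_fact_le_norm_pochhammer:
  fixes c :: complex
  assumes "c \<notin> \<int>"
  obtains K where "K > 0" "\<And>i k. shifted_fact i k \<le> K ^ k * norm (pochhammer (c + of_int i) k)"
proof -
  have "open (- \<int> :: complex set)" by (simp add: open_Compl)
  then obtain e where e: "e > 0" "ball c e \<subseteq> - \<int>"
    using assms by (meson ComplI open_contains_ball)
  have far: "e \<le> norm (c + of_int j)" for j :: int
  proof (rule ccontr)
    assume "\<not> e \<le> norm (c + of_int j)"
    then have "of_int (- j) \<in> ball c e" by (simp add: dist_norm)
    with e(2) show False by (meson ComplD Ints_of_int subsetD)
  qed
  define K where "K = (1 + norm c) / e + 1"
  have K: "K > 0" using e(1) by (simp add: K_def add_nonneg_pos)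
  have lin: "1 + \<bar>real_of_int j\<bar> \<le> K * norm (c + of_int j)" for j
  proof -
    have "\<bar>real_of_int j\<bar> = norm ((c + of_int j) - c)" by simp
    also have "\<dots> \<le> norm (c + of_int j) + norm c" by (rule norm_triangle_ineq4)
    finally have "1 + \<bar>real_of_int j\<bar> \<le> (1 + norm c) / e * e + norm (c + of_int j)"
      using e(1) by simp
    also have "(1 + norm c) / e * e \<le> (1 + norm c) / e * norm (c + of_int j)"
      using far e(1) by (intro mult_left_mono) auto
    finally show ?thesis by (simp add: K_def algebra_simps)
  qed
  have "shifted_fact i k \<le> K ^ k * norm (pochhammer (c + of_int i) k)" for i k
  proof (induction k)
    case 0
    show ?case by (simp add: shifted_fact_def)
  next
    case (Suc k)
    have "shifted_fact i k * (1 + \<bar>real_of_int i + real k\<bar>)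
      \<le> (K ^ k * norm (pochhammer (c + of_int i) k)) * (K * norm (c + of_int i + of_nat k))"
      using Suc lin[of "i + int k"] K by (intro mult_mono) (auto simp: add.assoc)
    then show ?case
      by (simp add: pochhammer_rec' shifted_fact_def norm_mult mult_ac)
  qed
  with K that show thesis by blast
qed

lemma pochhammer_nonint_neq_0:
  fixes c :: complex
  assumes "c \<notin> \<int>"
  shows "pochhammer (c + of_int i) k \<noteq> 0"
  using shifted_fact_le_norm_pochhammer[OF assms] shifted_fact_pos
  by (metis mult_zero_right norm_zero not_le)

lemma norm_pochhammer_quotient_le:
  fixes a c :: complex
  assumes "c \<notin> \<int>"
  obtains K where "K > 0"
    "\<And>i k. norm (pochhammer (a + of_int i) k / pochhammer (c + of_int i) k) \<le> K ^ k"
proof -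
  obtain L where L: "L > 0" "\<And>i k. shifted_fact i k \<le> L ^ k * norm (pochhammer (c + of_int i) k)"
    using shifted_fact_le_norm_pochhammer[OF assms] by blast
  have "norm (pochhammer (a + of_int i) k / pochhammer (c + of_int i) k) \<le> ((1 + norm a) * L) ^ k"
    for i k
  proof -
    have "norm (pochhammer (a + of_int i) k)
        \<le> (1 + norm a) ^ k * (L ^ k * norm (pochhammer (c + of_int i) k))"
      using norm_pochhammer_le L(2) by (rule order_trans[OF _ mult_left_mono]) auto
    then show ?thesis
      using pochhammer_nonint_neq_0[OF assms]
      by (simp add: norm_divide pos_divide_le_eq power_mult_distrib mult_ac)
  qed
  moreover have "(1 + norm a) * L > 0" using L(1) by (simp add: add_pos_nonneg)
  ultimately show thesis using that by blast
qed

section \<open>Tails of series with factorially decaying terms\<close>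

lemma summable_power_div_fact: "summable (\<lambda>m. (x::real) ^ m / fact m)"
  using summable_exp[of x] by (simp add: field_simps)

lemma exp_eq_suminf: "exp (x :: 'a :: {banach,real_normed_field}) = (\<Sum>m. x ^ m / fact m)"
  by (simp add: exp_def scaleR_conv_of_real divide_inverse mult.commute)

text \<open>
  The tail beyond \<open>N\<close> is dominated by \<open>n\<^sup>-\<^sup>N\<close> times the exponential series of \<open>2 B\<close>, the \<open>2\<close> being the
  loss in \<open>fact_le_shifted_fact\<close>.
\<close>
lemma series_tail_bigo:
  fixes t :: "nat \<Rightarrow> nat \<Rightarrow> complex"
  assumes M: "M \<ge> 0" and B: "B \<ge> 0"
    and bound: "\<And>n k. norm (t n k) * shifted_fact (- int n) k \<le> M * B ^ k"
  shows "(\<lambda>n. (\<Sum>k. t n k) - (\<Sum>k<N. t n k)) \<in> O(\<lambda>n. of_nat n powi (- int N))"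
proof -
  define E where "E = M * B ^ N * fact N"
  have term_le: "norm (t n (m + N)) \<le> E / (real n + 1) ^ N * ((2 * B) ^ m / fact m)" for n m
  proof -
    have "norm (t n (m + N)) * ((real n + 1) ^ N * fact m)
        \<le> norm (t n (m + N)) * (fact N * 2 ^ m * shifted_fact (- int n) (N + m))"
      by (intro mult_left_mono power_fact_le_shifted_fact) auto
    also have "\<dots> = (norm (t n (m + N)) * shifted_fact (- int n) (m + N)) * (fact N * 2 ^ m)"
      by (simp add: mult_ac add.commute)
    also have "\<dots> \<le> (M * B ^ (m + N)) * (fact N * 2 ^ m)"
      by (intro mult_right_mono bound) auto
    also have "\<dots> = E * (2 * B) ^ m"
      by (simp add: E_def power_add power_mult_distrib)
    finally have "norm (t n (m + N)) \<le> E * (2 * B) ^ m / ((real n + 1) ^ N * fact m)"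
      by (subst pos_le_divide_eq) auto
    then show ?thesis by simp
  qed
  have tail: "norm ((\<Sum>k. t n k) - (\<Sum>k<N. t n k)) \<le> E / (real n + 1) ^ N * exp (2 * B)" for n
  proof -
    have sums: "summable (\<lambda>m. E / (real n + 1) ^ N * ((2 * B) ^ m / fact m))"
      by (intro summable_mult summable_power_div_fact)
    have "summable (\<lambda>m. t n (m + N))"
      by (rule summable_comparison_test'[OF sums]) (rule term_le)
    then have "summable (t n)" by (simp add: summable_iff_shift)
    then have "(\<Sum>k. t n k) - (\<Sum>k<N. t n k) = (\<Sum>m. t n (m + N))"
      by (simp add: suminf_minus_initial_segment)
    moreover have "norm (\<Sum>m. t n (m + N)) \<le> (\<Sum>m. E / (real n + 1) ^ N * ((2 * B) ^ m / fact m))"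
      by (rule norm_suminf_le[OF term_le sums])
    moreover have "(\<Sum>m. E / (real n + 1) ^ N * ((2 * B) ^ m / fact m))
        = E / (real n + 1) ^ N * exp (2 * B)"
      unfolding exp_eq_suminf by (rule suminf_mult[OF summable_power_div_fact])
    ultimately show ?thesis by simp
  qed
  have E: "E \<ge> 0" using M B by (simp add: E_def)
  have "norm ((\<Sum>k. t n k) - (\<Sum>k<N. t n k))
      \<le> (E * exp (2 * B)) * norm (of_nat n powi (- int N) :: complex)" if "n \<ge> 1" for n
  proof -
    have "E / (real n + 1) ^ N * exp (2 * B) \<le> E / real n ^ N * exp (2 * B)"
      using that E by (intro mult_right_mono divide_left_mono power_mono) auto
    also have "\<dots> = (E * exp (2 * B)) * norm (of_nat n powi (- int N) :: complex)"
      by (simp add: power_int_minus norm_inverse norm_power divide_inverse)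
    finally show ?thesis using tail[of n] by linarith
  qed
  then show ?thesis
    by (intro bigoI[of _ "E * exp (2 * B)"] eventually_sequentiallyI[of 1])
qed

section \<open>Transforming the series by the Chu--Vandermonde identity\<close>

lemma suminf_antidiagonals:
  fixes f :: "nat \<Rightarrow> nat \<Rightarrow> complex"
  assumes bound: "\<And>k m. norm (f k m) \<le> g k * h m"
    and g: "\<And>k. g k \<ge> 0" "summable g" and h: "\<And>m. h m \<ge> 0" "summable h"
  shows "(\<Sum>k. \<Sum>m. f k m) = (\<Sum>n. \<Sum>k\<le>n. f k (n - k))"
proof -
  let ?f = "\<lambda>(k, m). f k m"
  have hg: "(g has_sum suminf g) UNIV" "(h has_sum suminf h) UNIV"
    using g h by (auto intro!: norm_summable_imp_has_sum summable_sums)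
  have "(\<lambda>(k, m). g k * h m) summable_on UNIV \<times> UNIV"
    using g(1) h(1) has_sum_imp_summable[OF has_sum_cmult_left[OF hg(1), of "suminf h"]]
    by (intro summable_on_SigmaI[where g = "\<lambda>k. g k * suminf h"])
       (auto intro!: has_sum_cmult_right hg(2))
  then have "(\<lambda>p. norm (?f p)) summable_on UNIV \<times> UNIV"
    by (rule Infinite_Sum.abs_summable_on_comparison_test') (use bound in auto)
  then have "?f summable_on UNIV \<times> UNIV" by (rule abs_summable_summable)
  then have S: "(?f has_sum infsum ?f (UNIV \<times> UNIV)) (UNIV \<times> UNIV)"
    by (rule has_sum_infsum)
  have row: "(f k has_sum (\<Sum>m. f k m)) UNIV" for k
  proof -
    have "summable (\<lambda>m. norm (f k m))"
      by (rule summable_comparison_test'[OF summable_mult[OF h(2), of "g k"]]) (simp add: bound)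
    then show ?thesis
      by (intro norm_summable_imp_has_sum summable_sums) (auto intro: summable_norm_cancel)
  qed
  have rows: "((\<lambda>k. \<Sum>m. f k m) has_sum infsum ?f (UNIV \<times> UNIV)) UNIV"
    by (rule has_sum_SigmaD[OF S]) (simp add: row)
  have "((\<lambda>(n, k). f k (n - k)) has_sum infsum ?f (UNIV \<times> UNIV)) (SIGMA n:UNIV. {..n})"
    using S
    by (subst (asm) has_sum_reindex_bij_witness[where j = "\<lambda>(k, m). (k + m, k)"
          and i = "\<lambda>(n, k). (k, n - k)" and T = "SIGMA n:UNIV. {..n}"
          and h = "\<lambda>(n, k). f k (n - k)"]) auto
  then have diag: "((\<lambda>n. \<Sum>k\<le>n. f k (n - k)) has_sum infsum ?f (UNIV \<times> UNIV)) UNIV"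
    by (rule has_sum_SigmaD) (auto intro: has_sum_finite)
  show ?thesis
    using rows diag by (metis has_sum_imp_sums sums_unique)
qed

text \<open>
  The Chu--Vandermonde evaluation of the terminating \<open>\<^sub>2F\<^sub>1\<close> with parameters \<open>- n\<close>, \<open>D - B\<close>, \<open>D\<close> at \<open>1\<close>,
  written with binomial coefficients: it expands \<open>(B)\<^sub>n/(D)\<^sub>n\<close> in the quotients
  \<open>(D - B)\<^sub>k/(D)\<^sub>k\<close>, whose numerators no longer change when \<open>B\<close> and \<open>D\<close> are shifted together.
\<close>
lemma Vandermonde_pochhammer_binomial:
  fixes B D :: complex
  assumes "\<And>i. D \<noteq> - of_nat i"
  shows "(\<Sum>k\<le>n. (-1) ^ k * of_nat (n choose k) * (pochhammer (D - B) k / pochhammer D k))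
    = pochhammer B n / pochhammer D n"
proof -
  have neg: "pochhammer (- of_nat n :: complex) k = (-1) ^ k * fact k * of_nat (n choose k)" for k
    using gbinomial_pochhammer[of "of_nat n :: complex" k]
    by (simp add: binomial_gbinomial power_mult_distrib flip: mult.assoc)
  have "pochhammer B n / pochhammer D n = (\<Sum>k=0..n. pochhammer (D - B) k
      * pochhammer (- of_nat n) k / (of_nat (fact k) * pochhammer D k))"
    using assms by (subst Vandermonde_pochhammer) auto
  also have "\<dots> = (\<Sum>k\<le>n. (-1) ^ k * of_nat (n choose k)
      * (pochhammer (D - B) k / pochhammer D k))"
    by (intro sum.cong) (auto simp: neg atMost_atLeast0)
  finally show ?thesis ..
qed

text \<open>
  Inserting the Chu--Vandermonde expansion into the left-hand side gives a sum over the triangle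
  \<open>k \<le> n\<close>; summing it along \<open>n = k + m\<close> with \<open>k\<close> fixed gives the right-hand side. The arbitrary
  coefficients \<open>u\<close> allow two uses: \<open>u = 1\<close> yields Kummer's transformation, and
  \<open>u m = (A)\<^sub>m/(C)\<^sub>m\<close> the expansion of a \<open>\<^sub>2F\<^sub>2\<close> in functions \<open>\<^sub>1F\<^sub>1\<close>.
\<close>
lemma pochhammer_quotient_series_transform:
  fixes B D z :: complex and u :: "nat \<Rightarrow> complex"
  assumes D: "D \<notin> \<int>" and K: "K \<ge> 0" and u: "\<And>m. norm (u m) \<le> K ^ m"
  shows "(\<Sum>m. u m * (pochhammer B m / pochhammer D m) * (z ^ m / fact m))
    = (\<Sum>k. pochhammer (D - B) k / pochhammer D k * ((- z) ^ k / fact k)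
          * (\<Sum>m. u (k + m) * (z ^ m / fact m)))"
proof -
  define w where "w k = pochhammer (D - B) k / pochhammer D k" for k
  define f where "f k m = w k * ((- z) ^ k / fact k) * (u (k + m) * (z ^ m / fact m))" for k m
  obtain L where L: "L > 0"
    "\<And>i k. norm (pochhammer (D - B + of_int i) k / pochhammer (D + of_int i) k) \<le> L ^ k"
    using norm_pochhammer_quotient_le[OF D] by metis
  have w: "norm (w k) \<le> L ^ k" for k
    using L(2)[of 0 k] by (simp add: w_def)
  have bound: "norm (f k m) \<le> (L * K * norm z) ^ k / fact k * ((K * norm z) ^ m / fact m)" for k m
  proof -
    have "norm (w k) * norm (u (k + m)) * (norm z ^ k / fact k * (norm z ^ m / fact m))
        \<le> L ^ k * K ^ (k + m) * (norm z ^ k / fact k * (norm z ^ m / fact m))"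
      using w u L(1) by (intro mult_right_mono mult_mono) auto
    then show ?thesis
      by (simp add: f_def norm_mult norm_divide norm_power power_mult_distrib power_add mult_ac)
  qed
  have inner: "summable (\<lambda>m. u (k + m) * (z ^ m / fact m))" for k
  proof (rule summable_comparison_test')
    show "summable (\<lambda>m. K ^ k * ((K * norm z) ^ m / fact m))"
      by (intro summable_mult summable_power_div_fact)
    show "norm (u (k + m) * (z ^ m / fact m)) \<le> K ^ k * ((K * norm z) ^ m / fact m)" for m
      using mult_right_mono[OF u[of "k + m"], of "norm z ^ m / fact m"]
      by (simp add: norm_mult norm_divide norm_power power_mult_distrib power_add mult_ac)
  qed
  have diag: "(\<Sum>k\<le>n. f k (n - k)) = u n * (pochhammer B n / pochhammer D n) * (z ^ n / fact n)"
    for n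
  proof -
    have "f k (n - k) = u n * (z ^ n / fact n) * ((-1) ^ k * of_nat (n choose k) * w k)"
      if "k \<le> n" for k
    proof -
      have "(- z) ^ k * z ^ (n - k) = (-1) ^ k * z ^ n"
        using that by (simp add: power_minus[of z] flip: power_add)
      then show ?thesis
        using that by (simp add: f_def binomial_fact field_simps)
    qed
    then have "(\<Sum>k\<le>n. f k (n - k))
        = u n * (z ^ n / fact n) * (\<Sum>k\<le>n. (-1) ^ k * of_nat (n choose k) * w k)"
      by (simp add: sum_distrib_left)
    also have "(\<Sum>k\<le>n. (-1) ^ k * of_nat (n choose k) * w k) = pochhammer B n / pochhammer D n"
      unfolding w_def using D by (intro Vandermonde_pochhammer_binomial) auto
    finally show ?thesis by (simp add: mult_ac)
  qed
  have "(\<Sum>k. \<Sum>m. f k m) = (\<Sum>n. \<Sum>k\<le>n. f k (n - k))"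
    using L(1) K by (intro suminf_antidiagonals[OF bound] summable_power_div_fact) auto
  moreover have "(\<Sum>m. f k m) = w k * ((- z) ^ k / fact k) * (\<Sum>m. u (k + m) * (z ^ m / fact m))"
    for k
    unfolding f_def by (rule suminf_mult[OF inner])
  ultimately show ?thesis
    by (simp only: diag w_def)
qed

lemma hypergeometric_1F1_series:
  "hypergeometric [A] [C] z = (\<Sum>m. pochhammer A m / pochhammer C m * (z ^ m / fact m))"
  by (simp add: hypergeometric_series)

text \<open>
  With \<open>u = 1\<close> every inner sum of the transformed series is the exponential series of \<open>z\<close>.
\<close>
lemma Kummer_transformation:
  assumes "C \<notin> \<int>"
  shows "hypergeometric [A] [C] z = exp z * hypergeometric [C - A] [C] (- z)"
proof -
  obtain L where L: "L > 0"
    "\<And>i k. norm (pochhammer (C - A + of_int i) k / pochhammer (C + of_int i) k) \<le> L ^ k"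
    using norm_pochhammer_quotient_le[OF assms] by metis
  have summ: "summable (\<lambda>k. pochhammer (C - A) k / pochhammer C k * ((- z) ^ k / fact k))"
  proof (rule summable_comparison_test'[OF summable_power_div_fact[of "L * norm z"]])
    show "norm (pochhammer (C - A) k / pochhammer C k * ((- z) ^ k / fact k))
        \<le> (L * norm z) ^ k / fact k" for k
      using mult_right_mono[OF L(2)[of 0 k], of "norm z ^ k / fact k"]
      by (simp add: norm_mult norm_divide norm_power power_mult_distrib)
  qed
  have "hypergeometric [A] [C] z
      = (\<Sum>k. pochhammer (C - A) k / pochhammer C k * ((- z) ^ k / fact k) * exp z)"
    using pochhammer_quotient_series_transform[OF assms, of 1 "\<lambda>_. 1" A z]
    by (simp add: hypergeometric_1F1_series exp_eq_suminf)
  also have "\<dots> = hypergeometric [C - A] [C] (- z) * exp z"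
    unfolding hypergeometric_1F1_series by (rule suminf_mult2[OF summ, symmetric])
  finally show ?thesis by (simp add: mult.commute)
qed

text \<open>
  For \<open>u m = (A)\<^sub>m/(C)\<^sub>m\<close> the shifted coefficient factors as
  \<open>u (k + m) = u k * (A + k)\<^sub>m/(C + k)\<^sub>m\<close>, so each inner sum is again a confluent function.
\<close>
lemma hypergeometric_2F2_as_1F1_series:
  assumes C: "C \<notin> \<int>" and D: "D \<notin> \<int>"
  shows "hypergeometric [A, B] [C, D] z
    = (\<Sum>k. pochhammer A k * pochhammer (D - B) k / (pochhammer C k * pochhammer D k)
          * ((- z) ^ k / fact k) * hypergeometric [A + of_nat k] [C + of_nat k] z)"
proof -
  define u where "u m = pochhammer A m / pochhammer C m" for m
  obtain K where K: "K > 0"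
    "\<And>i k. norm (pochhammer (A + of_int i) k / pochhammer (C + of_int i) k) \<le> K ^ k"
    using norm_pochhammer_quotient_le[OF C] by metis
  have u: "norm (u m) \<le> K ^ m" for m
    using K(2)[of 0 m] by (simp add: u_def)
  have summ: "summable (\<lambda>m. pochhammer (A + of_nat k) m / pochhammer (C + of_nat k) m
      * (z ^ m / fact m))" for k
  proof (rule summable_comparison_test'[OF summable_power_div_fact[of "K * norm z"]])
    show "norm (pochhammer (A + of_nat k) m / pochhammer (C + of_nat k) m * (z ^ m / fact m))
        \<le> (K * norm z) ^ m / fact m" for m
      using mult_right_mono[OF K(2)[of "int k" m], of "norm z ^ m / fact m"]
      by (simp add: norm_mult norm_divide norm_power power_mult_distrib)
  qed
  have inner: "(\<Sum>m. u (k + m) * (z ^ m / fact m))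
      = u k * hypergeometric [A + of_nat k] [C + of_nat k] z" for k
    unfolding hypergeometric_1F1_series suminf_mult[OF summ, symmetric]
    by (simp add: u_def pochhammer_product' mult_ac)
  have "hypergeometric [A, B] [C, D] z
      = (\<Sum>m. u m * (pochhammer B m / pochhammer D m) * (z ^ m / fact m))"
    by (simp add: hypergeometric_series u_def mult_ac)
  also have "\<dots> = (\<Sum>k. pochhammer (D - B) k / pochhammer D k * ((- z) ^ k / fact k)
      * (u k * hypergeometric [A + of_nat k] [C + of_nat k] z))"
    using pochhammer_quotient_series_transform[OF D _ u, of B z] K(1)
    by (simp only: inner less_imp_le)
  finally show ?thesis by (simp add: u_def mult_ac)
qed

lemma norm_hypergeometric_1F1_shift_le:
  fixes a c z :: complex
  assumes "c \<notin> \<int>"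
  obtains M where "\<And>i. norm (hypergeometric [a + of_int i] [c + of_int i] z) \<le> M"
proof -
  obtain K where K: "K > 0"
    "\<And>i k. norm (pochhammer (a + of_int i) k / pochhammer (c + of_int i) k) \<le> K ^ k"
    using norm_pochhammer_quotient_le[OF assms] by metis
  have "norm (hypergeometric [a + of_int i] [c + of_int i] z) \<le> exp (K * norm z)" for i
    unfolding hypergeometric_1F1_series exp_eq_suminf
  proof (rule norm_suminf_le[OF _ summable_power_div_fact])
    show "norm (pochhammer (a + of_int i) m / pochhammer (c + of_int i) m * (z ^ m / fact m))
        \<le> (K * norm z) ^ m / fact m" for m
      using mult_right_mono[OF K(2)[of i m], of "norm z ^ m / fact m"]
      by (simp add: norm_mult norm_divide norm_power power_mult_distrib)
  qed
  then show thesis using that by blast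
qed

section \<open>The two expansions\<close>

text \<open>
  This covers both expansions, with \<open>e = b\<close> in the first and \<open>e = d - b\<close> in the second. Of the two
  denominators \<open>(c - n)\<^sub>k\<close> is spent on balancing \<open>(a - n)\<^sub>k\<close>, the factorial \<open>k!\<close> on balancing \<open>(e)\<^sub>k\<close>,
  and \<open>(d - n)\<^sub>k\<close> is what pays for the comparison product.
\<close>
lemma norm_2F2_coefficient_le:
  fixes a c d e z :: complex
  assumes c: "c \<notin> \<int>" and d: "d \<notin> \<int>"
  obtains B where "B \<ge> 0"
    "\<And>n k. norm (pochhammer (a - of_nat n) k * pochhammer e k
        / (pochhammer (c - of_nat n) k * pochhammer (d - of_nat n) k) * (z ^ k / fact k))
      * shifted_fact (- int n) k \<le> B ^ k"
proof -
  obtain K where K: "K > 0"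
    "\<And>i k. norm (pochhammer (a + of_int i) k / pochhammer (c + of_int i) k) \<le> K ^ k"
    using norm_pochhammer_quotient_le[OF c] by metis
  obtain L where L: "L > 0" "\<And>i k. shifted_fact i k \<le> L ^ k * norm (pochhammer (d + of_int i) k)"
    using shifted_fact_le_norm_pochhammer[OF d] by blast
  define B where "B = K * (1 + norm e) * L * norm z"
  have "norm (pochhammer (a - of_nat n) k * pochhammer e k
        / (pochhammer (c - of_nat n) k * pochhammer (d - of_nat n) k) * (z ^ k / fact k))
      * shifted_fact (- int n) k \<le> B ^ k" for n k
  proof -
    have ac: "norm (pochhammer (a - of_nat n) k / pochhammer (c - of_nat n) k) \<le> K ^ k"
      using K(2)[of "- int n" k] by simp
    have e: "norm (pochhammer e k) / fact k \<le> (1 + norm e) ^ k"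
      using norm_pochhammer_le[of e 0 k] by (simp add: shifted_fact_0_left pos_divide_le_eq)
    have d: "shifted_fact (- int n) k / norm (pochhammer (d - of_nat n) k) \<le> L ^ k"
      using L(2)[of "- int n" k] pochhammer_nonint_neq_0[OF d, of "- int n" k]
      by (simp add: pos_divide_le_eq)
    have "norm (pochhammer (a - of_nat n) k / pochhammer (c - of_nat n) k)
        * (norm (pochhammer e k) / fact k)
        * (shifted_fact (- int n) k / norm (pochhammer (d - of_nat n) k)) * norm z ^ k
        \<le> K ^ k * (1 + norm e) ^ k * L ^ k * norm z ^ k"
      using K(1) L(1) shifted_fact_pos[of "- int n" k]
      by (intro mult_right_mono mult_mono ac e d) (auto intro: less_imp_le)
    then show ?thesis
      by (simp add: B_def norm_mult norm_divide norm_power power_mult_distrib mult_ac)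
  qed
  moreover have "B \<ge> 0" using K(1) L(1) by (simp add: B_def)
  ultimately show thesis using that by blast
qed

theorem theorem4p7:
  fixes a b c d z :: complex
  shows
    "(c \<notin> \<int> \<and> d \<notin> \<int> \<longrightarrow>
       (\<forall>N::nat. N > 0 \<longrightarrow>
         (\<lambda>n::nat.
            hypergeometric [a - of_nat n, b] [c - of_nat n, d - of_nat n] z
            - (\<Sum>k<N. pochhammer (a - of_nat n) k * pochhammer b k
                     / (pochhammer (c - of_nat n) k * pochhammer (d - of_nat n) k)
                     * (z ^ k / fact k)))
         \<in> O[sequentially](\<lambda>n. of_nat n powi (- int N))))
     \<and>
     (a \<notin> \<int> \<and> b \<notin> \<int> \<and> c \<notin> \<int> \<and> d \<notin> \<int> \<longrightarrow>
       (\<forall>N::nat. N > 0 \<longrightarrow>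
         (\<lambda>n::nat.
            hypergeometric [a - of_nat n, b - of_nat n] [c - of_nat n, d - of_nat n] z
            - exp z *
              (\<Sum>k<N. pochhammer (a - of_nat n) k * pochhammer (d - b) k
                     / (pochhammer (c - of_nat n) k * pochhammer (d - of_nat n) k)
                     * ((- z) ^ k / fact k)
                     * hypergeometric [c - a] [c - of_nat n + of_nat k] (- z)))
         \<in> O[sequentially](\<lambda>n. of_nat n powi (- int N))))"
proof (intro conjI impI allI)
  fix N :: nat
  assume "c \<notin> \<int> \<and> d \<notin> \<int>"
  then obtain B where B: "B \<ge> 0"
    "\<And>n k. norm (pochhammer (a - of_nat n) k * pochhammer b k
        / (pochhammer (c - of_nat n) k * pochhammer (d - of_nat n) k) * (z ^ k / fact k))
      * shifted_fact (- int n) k \<le> B ^ k"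
    using norm_2F2_coefficient_le[of c d a b z] by blast
  show "(\<lambda>n::nat.
            hypergeometric [a - of_nat n, b] [c - of_nat n, d - of_nat n] z
            - (\<Sum>k<N. pochhammer (a - of_nat n) k * pochhammer b k
                     / (pochhammer (c - of_nat n) k * pochhammer (d - of_nat n) k)
                     * (z ^ k / fact k)))
         \<in> O[sequentially](\<lambda>n. of_nat n powi (- int N))"
    using series_tail_bigo[of 1 B "\<lambda>n k. pochhammer (a - of_nat n) k * pochhammer b k
        / (pochhammer (c - of_nat n) k * pochhammer (d - of_nat n) k) * (z ^ k / fact k)" N] B
    by (simp add: hypergeometric_series)
next
  fix N :: nat
  assume "a \<notin> \<int> \<and> b \<notin> \<int> \<and> c \<notin> \<int> \<and> d \<notin> \<int>"
  then have c: "c \<notin> \<int>" and d: "d \<notin> \<int>" by auto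
  define p where "p n k = pochhammer (a - of_nat n) k * pochhammer (d - b) k
      / (pochhammer (c - of_nat n) k * pochhammer (d - of_nat n) k) * ((- z) ^ k / fact k)" for n k
  define F where "F n k = hypergeometric [a - of_nat n + of_nat k] [c - of_nat n + of_nat k] z"
    for n k :: nat
  have shift: "c - of_nat n \<notin> \<int>" "d - of_nat n \<notin> \<int>" "c - of_nat n + of_nat k \<notin> \<int>" for n k
  proof -
    show "c - of_nat n \<notin> \<int>" "d - of_nat n \<notin> \<int>"
      using c d by (metis Ints_add Ints_of_nat diff_add_cancel)+
    then show "c - of_nat n + of_nat k \<notin> \<int>"
      by (metis Ints_diff Ints_of_nat add_diff_cancel)
  qed
  obtain B where B: "B \<ge> 0" "\<And>n k. norm (p n k) * shifted_fact (- int n) k \<le> B ^ k"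
    unfolding p_def using norm_2F2_coefficient_le[OF c d] by metis
  obtain M where M: "\<And>i. norm (hypergeometric [a + of_int i] [c + of_int i] z) \<le> M"
    using norm_hypergeometric_1F1_shift_le[OF c] by blast
  have M0: "M \<ge> 0" using M[of 0] norm_ge_zero order_trans by blast
  have F: "norm (F n k) \<le> M" for n k
    using M[of "int k - int n"] by (simp add: F_def algebra_simps)
  have "norm (p n k * F n k) * shifted_fact (- int n) k \<le> M * B ^ k" for n k
    using mult_mono[OF F[of n k] B(2)[of n k]] M0 shifted_fact_pos[of "- int n" k]
    by (simp add: norm_mult mult_ac)
  then have tail: "(\<lambda>n. (\<Sum>k. p n k * F n k) - (\<Sum>k<N. p n k * F n k))
      \<in> O(\<lambda>n. of_nat n powi (- int N))"
    by (intro series_tail_bigo[OF M0 B(1)])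
  have series: "hypergeometric [a - of_nat n, b - of_nat n] [c - of_nat n, d - of_nat n] z
      = (\<Sum>k. p n k * F n k)" for n
    using hypergeometric_2F2_as_1F1_series[OF shift(1)[of n] shift(2)[of n], of "a - of_nat n" "b - of_nat n" z]
    by (simp add: p_def F_def)
  have Kummer: "F n k = exp z * hypergeometric [c - a] [c - of_nat n + of_nat k] (- z)" for n k
    unfolding F_def using Kummer_transformation[OF shift(3)[of n k], of "a - of_nat n + of_nat k" z]
    by simp
  show "(\<lambda>n::nat.
            hypergeometric [a - of_nat n, b - of_nat n] [c - of_nat n, d - of_nat n] z
            - exp z *
              (\<Sum>k<N. pochhammer (a - of_nat n) k * pochhammer (d - b) k
                     / (pochhammer (c - of_nat n) k * pochhammer (d - of_nat n) k)
                     * ((- z) ^ k / fact k)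
                     * hypergeometric [c - a] [c - of_nat n + of_nat k] (- z)))
         \<in> O[sequentially](\<lambda>n. of_nat n powi (- int N))"
    using tail unfolding series Kummer by (simp add: p_def sum_distrib_left mult_ac)
qed

end
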